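(* Let $\alpha\in(0,1)$. A set $\mathrm{K}\subset C^1_{0,+}(\mathbb{R})$ is precompact (in $C^1_{0,+}(\mathbb{R})$) if for any $x\in\mathbb{R}$ there exist $A_x,\delta_x>0$ such that $\mathrm{K}\subset\mathsf{LocH\ddot{o}lObs}^{\alpha}(x,\delta_x,A_x)$.
   Context: $C^1_{0,+}(\mathbb{R})=\{f\in C^1(\mathbb{R}): f(0)=0,\ f'(0)=1,\ f'(t)>0\ \forall t\}$, with the metrisable topology of uniform convergence of $f$ and $f'$ on compact subsets of $\mathbb{R}$. For such $f$ and $s\ne t\in\mathbb{R}$, $\mathcal{O}(f;s,t)_0=\frac{\sqrt{f'(s)f'(t)}}{|f(t)-f(s)|}$. The set $\mathsf{LocH\ddot{o}lObs}^{\alpha}(x,\delta,A)$ consists of all $f\in C^1_{0,+}(\mathbb{R})$ such that $\left|\mathcal{O}(f;s,t)_0-\frac1{|t-s|}\right|\le A|t-s|^{\alpha-1}$ for all $s\neq t\in(x-\delta,x+\delta)$. Precompact means that the closure is compact (every sequence in $\mathrm{K}$ has a subsequence converging in $C^1_{0,+}(\mathbb{R})$). *)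

theory Defs
  imports "HOL-Analysis.Analysis"
begin

definition C1_0p :: "(real \<Rightarrow> real) set" where
  "C1_0p = {f. f C1_differentiable_on UNIV \<and> f 0 = 0 \<and> deriv f 0 = 1 \<and> (\<forall>t. deriv f t > 0)}"

definition C1_nbhd :: "(real \<Rightarrow> real) \<Rightarrow> real set \<Rightarrow> real \<Rightarrow> (real \<Rightarrow> real) set" where
  "C1_nbhd f C e =
     {g \<in> C1_0p. \<forall>t\<in>C. \<bar>g t - f t\<bar> < e \<and> \<bar>deriv g t - deriv f t\<bar> < e}"

text \<open>
  The topology of uniform convergence of functions and first derivatives on compact sets;
  \<open>limitin_C1_0p_topology\<close> below confirms that its convergence is the expected one.
\<close>

definition C1_0p_topology :: "(real \<Rightarrow> real) topology" where
  "C1_0p_topology = topology (\<lambda>U. U \<subseteq> C1_0p \<and>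
     (\<forall>f\<in>U. \<exists>C e. compact C \<and> 0 < e \<and> C1_nbhd f C e \<subseteq> U))"

definition precompactin :: "'a topology \<Rightarrow> 'a set \<Rightarrow> bool" where
  "precompactin T K \<longleftrightarrow> K \<subseteq> topspace T \<and> compactin T (T closure_of K)"

definition obs0 :: "(real \<Rightarrow> real) \<Rightarrow> real \<Rightarrow> real \<Rightarrow> real" where
  "obs0 f s t = sqrt (deriv f s * deriv f t) / \<bar>f t - f s\<bar>"

definition LocHolObs :: "real \<Rightarrow> real \<Rightarrow> real \<Rightarrow> real \<Rightarrow> (real \<Rightarrow> real) set" where
  "LocHolObs \<alpha> x \<delta> A = {f \<in> C1_0p.
     \<forall>s\<in>{x - \<delta><..<x + \<delta>}. \<forall>t\<in>{x - \<delta><..<x + \<delta>}. s \<noteq> t \<longrightarrow>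
       \<bar>obs0 f s t - 1 / \<bar>t - s\<bar>\<bar> \<le> A * \<bar>t - s\<bar> powr (\<alpha> - 1)}"

lemma C1_nbhd_mono: "C \<subseteq> C' \<Longrightarrow> e' \<le> e \<Longrightarrow> C1_nbhd f C' e' \<subseteq> C1_nbhd f C e"
  unfolding C1_nbhd_def by force

lemma istopology_C1_0p:
  "istopology (\<lambda>U. U \<subseteq> C1_0p \<and>
     (\<forall>f\<in>U. \<exists>C e. compact C \<and> 0 < e \<and> C1_nbhd f C e \<subseteq> U))"
  (is "istopology ?P")
proof -
  have "?P (S \<inter> T)" if S: "?P S" and T: "?P T" for S T
  proof (intro conjI ballI)
    show "S \<inter> T \<subseteq> C1_0p" using S by blast
  next
    fix f assume "f \<in> S \<inter> T"
    then obtain C e C' e' where "compact C" "0 < e" "C1_nbhd f C e \<subseteq> S"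
        "compact C'" "0 < e'" "C1_nbhd f C' e' \<subseteq> T"
      using S T by (metis IntD1 IntD2)
    then show "\<exists>C e. compact C \<and> 0 < e \<and> C1_nbhd f C e \<subseteq> S \<inter> T"
      using C1_nbhd_mono[of C "C \<union> C'" "min e e'" e f]
        C1_nbhd_mono[of C' "C \<union> C'" "min e e'" e' f]
      by (intro exI[of _ "C \<union> C'"] exI[of _ "min e e'"]) auto
  qed
  moreover have "?P (\<Union>\<K>)" if "\<forall>U\<in>\<K>. ?P U" for \<K>
  proof (intro conjI ballI)
    show "\<Union>\<K> \<subseteq> C1_0p" using that by blast
  next
    fix f assume "f \<in> \<Union>\<K>"
    then obtain U where "U \<in> \<K>" "f \<in> U" by blast
    with that obtain C e where "compact C" "0 < e" "C1_nbhd f C e \<subseteq> U" by metis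
    then show "\<exists>C e. compact C \<and> 0 < e \<and> C1_nbhd f C e \<subseteq> \<Union>\<K>"
      using \<open>U \<in> \<K>\<close> by blast
  qed
  ultimately show ?thesis
    unfolding istopology_def by blast
qed

lemma openin_C1_0p_topology:
  "openin C1_0p_topology U \<longleftrightarrow> U \<subseteq> C1_0p \<and>
     (\<forall>f\<in>U. \<exists>C e. compact C \<and> 0 < e \<and> C1_nbhd f C e \<subseteq> U)"
  unfolding C1_0p_topology_def using topology_inverse'[OF istopology_C1_0p] by simp

lemma topspace_C1_0p_topology [simp]: "topspace C1_0p_topology = C1_0p"
proof -
  have "openin C1_0p_topology C1_0p"
    unfolding openin_C1_0p_topology C1_nbhd_def
    by (intro conjI ballI exI[of _ "{}"] exI[of _ 1]) auto
  then show ?thesis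
    using openin_subset[of C1_0p_topology] openin_topspace[of C1_0p_topology]
    unfolding openin_C1_0p_topology by blast
qed

lemma C1_0p_continuous:
  assumes "f \<in> C1_0p"
  shows "continuous_on S f" "continuous_on S (deriv f)"
proof -
  obtain D where D: "\<And>x. (f has_vector_derivative D x) (at x)" "continuous_on UNIV D"
    using assms unfolding C1_0p_def C1_differentiable_on_def by auto
  then have "DERIV f x :> D x" for x
    by (simp add: has_real_derivative_iff_has_vector_derivative)
  then have "deriv f = D" "continuous_on UNIV f"
    by (auto intro!: DERIV_imp_deriv DERIV_isCont continuous_at_imp_continuous_on)
  with D show "continuous_on S f" "continuous_on S (deriv f)"
    by (auto intro: continuous_on_subset)
qed

lemma openin_C1_nbhd:
  assumes "f \<in> C1_0p" "compact C"
  shows "openin C1_0p_topology (C1_nbhd f C e)"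
  unfolding openin_C1_0p_topology
proof (intro conjI ballI)
  show "C1_nbhd f C e \<subseteq> C1_0p" by (auto simp: C1_nbhd_def)
next
  fix g assume g: "g \<in> C1_nbhd f C e"
  let ?m = "\<lambda>t. max \<bar>g t - f t\<bar> \<bar>deriv g t - deriv f t\<bar>"
  have "g \<in> C1_0p" using g by (simp add: C1_nbhd_def)
  then have cont: "continuous_on C ?m"
    by (intro continuous_intros C1_0p_continuous assms)
  obtain d where d: "d > 0" "\<And>t. t \<in> C \<Longrightarrow> ?m t \<le> e - d"
  proof (cases "C = {}")
    case False
    then obtain u where "u \<in> C" "\<And>t. t \<in> C \<Longrightarrow> ?m t \<le> ?m u"
      using continuous_attains_sup[OF assms(2) _ cont] by blast
    moreover have "?m u < e" using g \<open>u \<in> C\<close> by (simp add: C1_nbhd_def)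
    ultimately show ?thesis using that[of "e - ?m u"] by simp
  qed (use that[of 1] in simp)
  have "C1_nbhd g C d \<subseteq> C1_nbhd f C e"
    unfolding C1_nbhd_def using d(2) by fastforce
  then show "\<exists>C' e'. compact C' \<and> 0 < e' \<and> C1_nbhd g C' e' \<subseteq> C1_nbhd f C e"
    using assms(2) d(1) by blast
qed

lemma limitin_C1_0p_topology:
  "limitin C1_0p_topology \<sigma> f F \<longleftrightarrow>
     f \<in> C1_0p \<and> (\<forall>\<^sub>F n in F. \<sigma> n \<in> C1_0p) \<and>
     (\<forall>C. compact C \<longrightarrow> uniform_limit C \<sigma> f F \<and>
        uniform_limit C (\<lambda>n. deriv (\<sigma> n)) (deriv f) F)"
  (is "?L \<longleftrightarrow> ?R")
proof
  assume L: ?L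
  then have f: "f \<in> C1_0p" by (auto dest: limitin_topspace)
  have ev: "\<forall>\<^sub>F n in F. \<sigma> n \<in> C1_nbhd f C e" if "compact C" "e > 0" for C e
  proof -
    have "f \<in> C1_nbhd f C e" using f that by (simp add: C1_nbhd_def)
    then show ?thesis
      using L openin_C1_nbhd[OF f that(1)] unfolding limitin_def by blast
  qed
  show ?R
  proof (intro conjI allI impI)
    show "f \<in> C1_0p" by (fact f)
    show "\<forall>\<^sub>F n in F. \<sigma> n \<in> C1_0p"
      using ev[of "{}" 1] by (auto simp: C1_nbhd_def)
  next
    fix C :: "real set" assume C: "compact C"
    show "uniform_limit C \<sigma> f F"
      by (rule uniform_limitI, rule eventually_mono[OF ev[OF C]])
        (auto simp: C1_nbhd_def dist_real_def)
    show "uniform_limit C (\<lambda>n. deriv (\<sigma> n)) (deriv f) F"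
      by (rule uniform_limitI, rule eventually_mono[OF ev[OF C]])
        (auto simp: C1_nbhd_def dist_real_def)
  qed
next
  assume R: ?R
  show ?L
    unfolding limitin_def
  proof (intro conjI allI impI)
    show "f \<in> topspace C1_0p_topology" using R by simp
  next
    fix U assume "openin C1_0p_topology U \<and> f \<in> U"
    then obtain C e where C: "compact C" "0 < e" "C1_nbhd f C e \<subseteq> U"
      unfolding openin_C1_0p_topology by metis
    have "\<forall>\<^sub>F n in F. \<forall>t\<in>C. dist (\<sigma> n t) (f t) < e"
      "\<forall>\<^sub>F n in F. \<forall>t\<in>C. dist (deriv (\<sigma> n) t) (deriv f t) < e"
      "\<forall>\<^sub>F n in F. \<sigma> n \<in> C1_0p"
      using R C by (auto intro: uniform_limitD)
    then show "\<forall>\<^sub>F n in F. \<sigma> n \<in> U"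
    proof eventually_elim
      case (elim n)
      then have "\<sigma> n \<in> C1_nbhd f C e" by (auto simp: C1_nbhd_def dist_real_def)
      then show ?case using C(3) by blast
    qed
  qed
qed

end

theory Submission
  imports Defs
begin

text \<open>
  The proof works with \<open>v = 1 / sqrt f'\<close>. Its virtue is that
  \<open>1 / obs0 f s t = (f t - f s) * v s * v t\<close>, so that splitting \<open>f t - f s\<close> at a point \<open>m\<close> between
  \<open>s\<close> and \<open>t\<close> gives the exact three-point identity

  \<open>v m / obs0 f s t = v t / obs0 f s m + v s / obs0 f m t\<close>

  (\<open>recip_root_deriv_three_points\<close>). The Hoelder hypothesis says precisely that each factor
  \<open>1 / obs0 f s t\<close> is \<open>t - s\<close> up to a relative error \<open>O((t - s) powr \<alpha>)\<close>. If there were no error,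
  the identity would say that \<open>v\<close> is affine; this is the case of Moebius maps, whose \<open>obs0\<close> is
  \<open>1 / (t - s)\<close> exactly. In general \<open>v\<close> is nearly affine on small scales, with errors uniform over
  the family, and this has two consequences.

  Bounds: as \<open>v\<close> is positive, its value at a midpoint controls its values at both ends. Hence \<open>v\<close>
  satisfies a Harnack inequality with constant 6 near every point. Chaining it along the connected
  line from the normalisation \<open>v 0 = 1\<close> bounds \<open>v\<close> from above and away from 0 near every point
  (\<open>recip_root_deriv_bounds\<close>).

  Equicontinuity: if \<open>t\<close> is kept at a small fixed distance \<open>r\<close> from \<open>s\<close> while \<open>m\<close> tends to \<open>s\<close>, the
  weight of \<open>v t\<close> in the identity vanishes and \<open>v m - v s\<close> is at most of order
  \<open>r powr \<alpha> + (m - s) / r\<close> (\<open>recip_root_deriv_increment\<close>). Choosing first \<open>r\<close> and then \<open>m - s\<close>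
  small makes this arbitrarily small.

  Both properties pass from \<open>v\<close> to \<open>f' = 1 / v ^ 2\<close>, and a criterion of Arzela--Ascoli type
  (\<open>precompactin_C1_0p_topologyI\<close>) concludes. The lower bound on \<open>f'\<close> is as essential as the upper
  one there: it keeps the limits inside the space of functions with positive derivative.
\<close>

section \<open>A compactness criterion of Arzela--Ascoli type\<close>

text \<open>
  For an equicontinuous family, pointwise and compact convergence agree: finitely many
  equicontinuity balls cover the compact set, and on each of them the centre decides. The filter is
  arbitrary because this is applied to neighbourhood filters of a product topology on functions,
  which sequences do not describe.
\<close>

lemma uniform_limit_if_equicontinuous:
  fixes P :: "('a::metric_space \<Rightarrow> 'b::metric_space) set"
  assumes C: "compact C"
    and equi: "\<And>x e. 0 < e \<Longrightarrow> \<exists>d>0. \<forall>h\<in>P. \<forall>y. dist y x < d \<longrightarrow> dist (h y) (h x) \<le> e"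
    and g: "g \<in> P" and ev: "\<forall>\<^sub>F n in F. \<sigma> n \<in> P"
    and lim: "\<And>x. x \<in> C \<Longrightarrow> ((\<lambda>n. \<sigma> n x) \<longlongrightarrow> g x) F"
  shows "uniform_limit C \<sigma> g F"
proof (rule uniform_limitI)
  fix e :: real assume "0 < e"
  then have "\<exists>d>0. \<forall>h\<in>P. \<forall>y. dist y x < d \<longrightarrow> dist (h y) (h x) \<le> e/4" for x
    using equi[of "e/4"] by simp
  then obtain d where d: "\<And>x. d x > 0"
      "\<And>x h y. h \<in> P \<Longrightarrow> dist y x < d x \<Longrightarrow> dist (h y) (h x) \<le> e/4"
    by metis
  have "C \<subseteq> (\<Union>x\<in>C. ball x (d x))" using d(1) by auto
  then obtain X where X: "X \<subseteq> C" "finite X" "C \<subseteq> (\<Union>x\<in>X. ball x (d x))"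
    by (rule compactE_image[OF C, of C "\<lambda>x. ball x (d x)", OF open_ball])
  have "\<forall>\<^sub>F n in F. dist (\<sigma> n x) (g x) < e/4" if "x \<in> X" for x
    by (rule tendstoD) (use lim X(1) that \<open>0 < e\<close> in auto)
  then have "\<forall>\<^sub>F n in F. \<forall>x\<in>X. dist (\<sigma> n x) (g x) < e/4"
    by (simp add: eventually_ball_finite X(2))
  with ev show "\<forall>\<^sub>F n in F. \<forall>y\<in>C. dist (\<sigma> n y) (g y) < e"
  proof eventually_elim
    case (elim n)
    show ?case
    proof
      fix y assume "y \<in> C"
      then obtain x where x: "x \<in> X" "dist y x < d x"
        using X(3) by (auto simp: dist_commute)
      have "dist (\<sigma> n y) (g y) \<le> dist (\<sigma> n y) (\<sigma> n x) + dist (\<sigma> n x) (g x) + dist (g y) (g x)"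
        using dist_triangle[of "\<sigma> n y" "g y" "\<sigma> n x"] dist_triangle[of "\<sigma> n x" "g y" "g x"]
        by (simp add: dist_commute)
      also have "\<dots> < e"
        using d(2)[OF elim(1) x(2)] d(2)[OF g x(2)] bspec[OF elim(2) x(1)] \<open>0 < e\<close> by linarith
      finally show "dist (\<sigma> n y) (g y) < e" .
    qed
  qed
qed

text \<open>
  By the mean value theorem, a primitive vanishing at 0 depends continuously on its derivative for
  the topology of compact convergence.
\<close>

lemma uniform_limit_antiderivative:
  fixes f :: "real \<Rightarrow> real"
  assumes C: "compact C"
    and f: "\<And>t. (f has_real_derivative f' t) (at t)" "f 0 = 0"
    and \<sigma>: "\<forall>\<^sub>F n in F. (\<forall>t. (\<sigma> n has_real_derivative \<sigma>' n t) (at t)) \<and> \<sigma> n 0 = 0"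
    and lim: "\<And>R. uniform_limit {-R..R} \<sigma>' f' F"
  shows "uniform_limit C \<sigma> f F"
proof (rule uniform_limitI)
  fix e :: real assume e: "0 < e"
  obtain R where R: "R > 0" "\<And>t. t \<in> C \<Longrightarrow> \<bar>t\<bar> \<le> R"
    using compact_imp_bounded[OF C] by (auto simp: bounded_pos)
  have "\<forall>\<^sub>F n in F. \<forall>t\<in>{-R..R}. dist (\<sigma>' n t) (f' t) < e / (2*R)"
    by (rule uniform_limitD[OF lim]) (use R e in simp)
  with \<sigma> show "\<forall>\<^sub>F n in F. \<forall>t\<in>C. dist (\<sigma> n t) (f t) < e"
  proof eventually_elim
    case (elim n)
    show ?case
    proof
      fix t assume t: "t \<in> C"
      have "norm ((\<sigma> n t - f t) - (\<sigma> n 0 - f 0)) \<le> e / (2*R) * norm (t - 0)"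
      proof (rule field_differentiable_bound[where S = "{-R..R}" and f' = "\<lambda>t. \<sigma>' n t - f' t"])
        show "((\<lambda>t. \<sigma> n t - f t) has_real_derivative \<sigma>' n z - f' z) (at z within {-R..R})" for z
          using elim f by (intro DERIV_diff) (auto intro: has_field_derivative_at_within)
        show "norm (\<sigma>' n z - f' z) \<le> e / (2*R)" if "z \<in> {-R..R}" for z
          using elim that by (force simp: dist_real_def)
      qed (use R t in \<open>auto simp: abs_le_iff\<close>, use R(2)[OF t] in linarith)
      also have "\<dots> \<le> e / (2*R) * R"
        using R t e by (intro mult_left_mono) auto
      also have "\<dots> < e" using R e by simp
      finally show "dist (\<sigma> n t) (f t) < e" using elim f by (simp add: dist_real_def)
    qed
  qed
qed

lemma C1_0p_has_derivative:
  assumes "f \<in> C1_0p"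
  shows "(f has_real_derivative deriv f t) (at t)"
  using assms unfolding C1_0p_def C1_differentiable_on_eq
  by (auto simp: DERIV_deriv_iff_real_differentiable differentiable_on_def)

lemma C1_0pI:
  assumes "\<And>t. (f has_real_derivative g t) (at t)" "continuous_on UNIV g"
    and "f 0 = 0" "g 0 = 1" "\<And>t. g t > 0"
  shows "f \<in> C1_0p" "deriv f = g"
proof -
  show g: "deriv f = g" using assms(1) by (auto intro: DERIV_imp_deriv)
  show "f \<in> C1_0p"
    using assms unfolding C1_0p_def mem_Collect_eq g C1_differentiable_on_def
      has_real_derivative_iff_has_vector_derivative by blast
qed

lemma Hausdorff_C1_0p_topology: "Hausdorff_space C1_0p_topology"
  unfolding Hausdorff_space_def topspace_C1_0p_topology
proof (intro allI impI)
  fix f g :: "real \<Rightarrow> real" assume fg: "f \<in> C1_0p \<and> g \<in> C1_0p \<and> f \<noteq> g"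
  then obtain t where t: "f t \<noteq> g t" by auto
  define e where "e = \<bar>f t - g t\<bar> / 2"
  have "e > 0" using t by (simp add: e_def)
  show "\<exists>U V. openin C1_0p_topology U \<and> openin C1_0p_topology V \<and> f \<in> U \<and> g \<in> V \<and> disjnt U V"
  proof (intro exI conjI)
    show "openin C1_0p_topology (C1_nbhd f {t} e)" "openin C1_0p_topology (C1_nbhd g {t} e)"
      using fg by (auto intro: openin_C1_nbhd)
    show "f \<in> C1_nbhd f {t} e" "g \<in> C1_nbhd g {t} e"
      using fg \<open>e > 0\<close> by (auto simp: C1_nbhd_def)
    show "disjnt (C1_nbhd f {t} e) (C1_nbhd g {t} e)"
    proof -
      have False if "\<bar>h t - f t\<bar> < e" "\<bar>h t - g t\<bar> < e" for h
      proof -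
        have "\<bar>f t - g t\<bar> \<le> \<bar>h t - f t\<bar> + \<bar>h t - g t\<bar>" by linarith
        also have "\<dots> < e + e" using that by (rule add_strict_mono)
        finally show False by (simp add: e_def)
      qed
      then show ?thesis unfolding disjnt_iff C1_nbhd_def by blast
    qed
  qed
qed

text \<open>
  The derivatives of \<open>K\<close> lie in a closed set \<open>P\<close> of functions that share the given pointwise bounds
  and the given modulus of continuity. By Tychonoff's theorem \<open>P\<close> is compact for pointwise
  convergence. On \<open>P\<close> this is compact convergence, so that taking the primitive that vanishes at 0
  is a continuous map from \<open>P\<close> to \<open>C1_0p\<close>. Its image is compact, closed because the target is
  Hausdorff, and contains \<open>K\<close>.
\<close>

theorem precompactin_C1_0p_topologyI:
  assumes K: "K \<subseteq> C1_0p"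
    and bounded: "\<And>t. \<exists>a b. 0 < a \<and> (\<forall>f\<in>K. a \<le> deriv f t \<and> deriv f t \<le> b)"
    and equicont: "\<And>t e. 0 < e \<Longrightarrow>
      \<exists>d>0. \<forall>f\<in>K. \<forall>s. \<bar>s - t\<bar> < d \<longrightarrow> \<bar>deriv f s - deriv f t\<bar> \<le> e"
  shows "precompactin C1_0p_topology K"
proof -
  obtain a b where ab: "\<And>t. 0 < a t" "\<And>f t. f \<in> K \<Longrightarrow> deriv f t \<in> {a t..b t}"
    using bounded unfolding atLeastAtMost_iff by metis
  obtain d where d: "\<And>t e. 0 < e \<Longrightarrow> 0 < d t e"
      "\<And>t e f s. 0 < e \<Longrightarrow> f \<in> K \<Longrightarrow> \<bar>s - t\<bar> < d t e \<Longrightarrow> \<bar>deriv f s - deriv f t\<bar> \<le> e"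
  proof -
    have "\<forall>t e. \<exists>d. 0 < e \<longrightarrow> 0 < d \<and>
        (\<forall>f\<in>K. \<forall>s. \<bar>s - t\<bar> < d \<longrightarrow> \<bar>deriv f s - deriv f t\<bar> \<le> e)"
      using equicont by blast
    then show thesis using that by metis
  qed
  define P :: "(real \<Rightarrow> real) set" where "P = (\<Pi>\<^sub>E t\<in>UNIV. {a t..b t}) \<inter>
    {g. g 0 = 1 \<and> (\<forall>t e s. 0 < e \<and> \<bar>s - t\<bar> < d t e \<longrightarrow> \<bar>g s - g t\<bar> \<le> e)}"
  have "compact (\<Pi>\<^sub>E t\<in>UNIV. {a t..b t})"
    using compactin_PiE[of "\<lambda>_. euclideanreal" UNIV "\<lambda>t. {a t..b t}"]
    by (simp add: euclidean_product_topology)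
  moreover have "closed {g :: real \<Rightarrow> real.
      g 0 = 1 \<and> (\<forall>t e s. 0 < e \<and> \<bar>s - t\<bar> < d t e \<longrightarrow> \<bar>g s - g t\<bar> \<le> e)}"
    by (intro closed_Collect_conj closed_Collect_all closed_Collect_imp closed_Collect_le
        closed_Collect_eq open_Collect_const continuous_intros continuous_on_product_coordinates)
  ultimately have "compact P" unfolding P_def by (rule compact_Int_closed)
  have equi: "\<exists>d>0. \<forall>h\<in>P. \<forall>y. dist y x < d \<longrightarrow> dist (h y) (h x) \<le> e" if "0 < e" for x e
    using d(1)[OF that] that unfolding P_def by (auto simp: dist_real_def)
  have cont: "continuous_on UNIV g" if "g \<in> P" for g
    unfolding continuous_on_iff
  proof (intro ballI allI impI)
    fix x e :: real assume "0 < e"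
    then show "\<exists>d>0. \<forall>y\<in>UNIV. dist y x < d \<longrightarrow> dist (g y) (g x) < e"
      using equi[of "e/2" x] that by fastforce
  qed
  have "\<exists>f. f 0 = 0 \<and> (\<forall>t. (f has_real_derivative g t) (at t))" if g: "g \<in> P" for g
  proof -
    obtain F where "\<And>t. (F has_real_derivative g t) (at t)"
      using einterval_antiderivative[of "-\<infinity>" "\<infinity>" g] cont[OF g]
      by (auto simp: has_real_derivative_iff_has_vector_derivative continuous_on_eq_continuous_at)
    then show ?thesis
      by (intro exI[of _ "\<lambda>t. F t - F 0"]) (auto intro!: derivative_eq_intros)
  qed
  then obtain \<Phi> where \<Phi>: "\<And>g. g \<in> P \<Longrightarrow> \<Phi> g 0 = 0"
      "\<And>g t. g \<in> P \<Longrightarrow> (\<Phi> g has_real_derivative g t) (at t)"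
    by metis
  have at_0: "g 0 = 1" and pos: "g t > 0" if "g \<in> P" for g t
  proof -
    show "g 0 = 1" using that by (simp add: P_def)
    have "g t \<in> {a t..b t}" using that unfolding P_def by blast
    then show "g t > 0" using ab(1)[of t] by simp
  qed
  have \<Phi>_mem: "\<Phi> g \<in> C1_0p" and \<Phi>_deriv: "deriv (\<Phi> g) = g" if "g \<in> P" for g
    using C1_0pI[OF \<Phi>(2)[OF that] cont[OF that] \<Phi>(1)[OF that] at_0[OF that] pos[OF that]]
    by blast+
  have "continuous_map (top_of_set P) C1_0p_topology \<Phi>"
    unfolding continuous_map_atin
  proof
    fix g assume "g \<in> topspace (top_of_set P)"
    then have g: "g \<in> P" by simp
    let ?F = "atin (top_of_set P) g"
    have "\<forall>\<^sub>F h in ?F. h \<in> topspace (top_of_set P)"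
      unfolding eventually_atin using g by (auto intro!: exI[of _ P])
    then have ev: "\<forall>\<^sub>F h in ?F. h \<in> P" by simp
    have "((\<lambda>h. h t) \<longlongrightarrow> g t) ?F" for t
    proof -
      have "continuous_map (top_of_set P) euclideanreal (\<lambda>h. h t)"
        by (auto intro: continuous_on_subset[OF continuous_on_product_coordinates])
      from limitin_continuous_map[OF this, of g] g show ?thesis by simp
    qed
    then have lim: "uniform_limit C (\<lambda>h. h) g ?F" if "compact C" for C
      using uniform_limit_if_equicontinuous[OF that equi g ev] by simp
    show "limitin C1_0p_topology \<Phi> (\<Phi> g) ?F"
      unfolding limitin_C1_0p_topology
    proof (intro conjI allI impI)
      show "\<Phi> g \<in> C1_0p" by (rule \<Phi>_mem[OF g])
      show "\<forall>\<^sub>F h in ?F. \<Phi> h \<in> C1_0p" by (rule eventually_mono[OF ev \<Phi>_mem])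
    next
      fix C :: "real set" assume C: "compact C"
      have "\<forall>\<^sub>F h in ?F. (\<forall>t. (\<Phi> h has_real_derivative h t) (at t)) \<and> \<Phi> h 0 = 0"
        by (rule eventually_mono[OF ev]) (simp add: \<Phi>)
      then show "uniform_limit C \<Phi> (\<Phi> g) ?F"
        by (rule uniform_limit_antiderivative[OF C \<Phi>(2)[OF g] \<Phi>(1)[OF g]])
          (simp add: lim)
      have "\<forall>\<^sub>F h in ?F. \<forall>t\<in>C. deriv (\<Phi> h) t = h t"
        by (rule eventually_mono[OF ev]) (simp add: \<Phi>_deriv)
      then show "uniform_limit C (\<lambda>h. deriv (\<Phi> h)) (deriv (\<Phi> g)) ?F"
        using lim[OF C] by (subst uniform_limit_cong) (simp_all add: \<Phi>_deriv[OF g])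
    qed
  qed
  moreover have "compactin (top_of_set P) P" using \<open>compact P\<close> by simp
  ultimately have compact: "compactin C1_0p_topology (\<Phi> ` P)" by (intro image_compactin)
  have "K \<subseteq> \<Phi> ` P"
  proof
    fix f assume f: "f \<in> K"
    then have fC: "f \<in> C1_0p" using K by blast
    then have P: "deriv f \<in> P" using ab(2) d(2) f by (auto simp: P_def C1_0p_def)
    have "\<forall>x. ((\<lambda>t. \<Phi> (deriv f) t - f t) has_real_derivative 0) (at x)"
      using DERIV_diff[OF \<Phi>(2)[OF P] C1_0p_has_derivative[OF fC]] by simp
    from DERIV_isconst_all[OF this, of _ 0]
    have "\<Phi> (deriv f) t - f t = \<Phi> (deriv f) 0 - f 0" for t .
    then have "\<Phi> (deriv f) = f" using \<Phi>(1)[OF P] fC by (auto simp: C1_0p_def)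
    with P show "f \<in> \<Phi> ` P" by force
  qed
  then have "C1_0p_topology closure_of K \<subseteq> \<Phi> ` P"
    by (rule closure_of_minimal) (rule compactin_imp_closedin[OF Hausdorff_C1_0p_topology compact])
  then have "compactin C1_0p_topology (C1_0p_topology closure_of K)"
    using closed_compactin[OF compact] by simp
  then show ?thesis using K by (simp add: precompactin_def)
qed

section \<open>The reciprocal root of the derivative\<close>

definition recip_root_deriv :: "(real \<Rightarrow> real) \<Rightarrow> real \<Rightarrow> real" where
  "recip_root_deriv f t = 1 / sqrt (deriv f t)"

lemma recip_root_deriv_pos: "f \<in> C1_0p \<Longrightarrow> 0 < recip_root_deriv f t"
  by (simp add: recip_root_deriv_def C1_0p_def)

lemma recip_root_deriv_0: "f \<in> C1_0p \<Longrightarrow> recip_root_deriv f 0 = 1"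
  by (simp add: recip_root_deriv_def C1_0p_def)

lemma deriv_eq_recip_root_deriv: "f \<in> C1_0p \<Longrightarrow> deriv f t = 1 / (recip_root_deriv f t)\<^sup>2"
  by (simp add: recip_root_deriv_def C1_0p_def power_divide less_imp_le)

lemma C1_0p_strict_mono:
  assumes "f \<in> C1_0p" "s < t"
  shows "f s < f t"
  using DERIV_pos_imp_increasing[OF assms(2), of f] C1_0p_has_derivative[OF assms(1)] assms(1)
  by (auto simp: C1_0p_def)

lemma obs0_pos:
  assumes "f \<in> C1_0p" "s < t"
  shows "0 < obs0 f s t"
  using C1_0p_strict_mono[OF assms] assms(1) by (simp add: obs0_def C1_0p_def)

lemma inverse_obs0_eq:
  assumes "f \<in> C1_0p" "s < t"
  shows "1 / obs0 f s t = (f t - f s) * recip_root_deriv f s * recip_root_deriv f t"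
  using C1_0p_strict_mono[OF assms] by (simp add: obs0_def recip_root_deriv_def real_sqrt_mult)

text \<open>
  After \<open>inverse_obs0_eq\<close> this is \<open>f t - f s = (f m - f s) + (f t - f m)\<close>, multiplied by the three
  values of \<open>recip_root_deriv f\<close>.
\<close>

lemma recip_root_deriv_three_points:
  assumes "f \<in> C1_0p" "s < m" "m < t"
  shows "recip_root_deriv f m * (1 / obs0 f s t) =
    recip_root_deriv f t * (1 / obs0 f s m) + recip_root_deriv f s * (1 / obs0 f m t)"
proof -
  have "s < t" using assms by simp
  show ?thesis
    unfolding inverse_obs0_eq[OF assms(1) \<open>s < t\<close>] inverse_obs0_eq[OF assms(1,2)]
      inverse_obs0_eq[OF assms(1,3)]
    by (simp add: algebra_simps)
qed

text \<open>
  The hypothesis bounds \<open>obs0 f s t\<close>, but the three-point identity involves its reciprocal. With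
  relative error \<open>\<theta> \<le> 1 / 2\<close>, passing to the reciprocal at most doubles the error.
\<close>

lemma inverse_obs0_approx:
  assumes f: "f \<in> LocHolObs \<alpha> x \<delta> A" and st: "x - \<delta> < s" "s < t" "t < x + \<delta>"
    and small: "A * (t - s) powr \<alpha> \<le> \<theta>" and \<theta>: "\<theta> \<le> 1 / 2"
  shows "\<bar>1 / obs0 f s t - (t - s)\<bar> \<le> 2 * \<theta> * (t - s)"
proof -
  define h where "h = t - s"
  define q where "q = obs0 f s t"
  have h: "0 < h" using st by (simp add: h_def)
  have q: "0 < q" using f st obs0_pos by (simp add: q_def LocHolObs_def)
  have "\<bar>q - 1 / h\<bar> \<le> A * h powr (\<alpha> - 1)"
  proof -
    have "s \<in> {x - \<delta><..<x + \<delta>}" "t \<in> {x - \<delta><..<x + \<delta>}" "s \<noteq> t" "\<bar>t - s\<bar> = h"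
      using st by (auto simp: h_def)
    with f show ?thesis unfolding LocHolObs_def q_def by fastforce
  qed
  then have "\<bar>q - 1 / h\<bar> * h \<le> A * h powr (\<alpha> - 1) * h"
    using h by (intro mult_right_mono) auto
  also have "\<dots> = A * h powr \<alpha>" using h by (simp add: powr_diff)
  also have "\<dots> \<le> \<theta>" using small by (simp add: h_def)
  also have "\<bar>q - 1 / h\<bar> * h = \<bar>q * h - 1\<bar>"
    using h by (simp add: abs_mult_pos left_diff_distrib)
  finally have 1: "\<bar>q * h - 1\<bar> \<le> \<theta>" .
  then have 2: "1 \<le> 2 * (q * h)" using \<theta> by linarith
  have "(1 / q - h) * q = 1 - q * h" using q by (simp add: field_simps)
  then have "\<bar>1 / q - h\<bar> * q = \<bar>q * h - 1\<bar>"
    using q by (metis abs_minus_commute abs_mult abs_of_pos)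
  also have "\<dots> \<le> \<theta> * (2 * (q * h))"
    using mult_left_mono[OF 2, of \<theta>] 1 by linarith
  also have "\<dots> = 2 * \<theta> * h * q" by simp
  finally show ?thesis using q by (simp add: h_def q_def)
qed

lemma inverse_obs0_bounds:
  assumes "f \<in> LocHolObs \<alpha> x \<delta> A" "x - \<delta> < s" "s < t" "t < x + \<delta>" "A * (t - s) powr \<alpha> \<le> 1 / 4"
  shows "(t - s) / 2 \<le> 1 / obs0 f s t" "1 / obs0 f s t \<le> 3 / 2 * (t - s)"
proof -
  have "\<bar>1 / obs0 f s t - (t - s)\<bar> \<le> 2 * (1 / 4) * (t - s)"
    by (rule inverse_obs0_approx[OF assms]) simp
  then have "\<bar>1 / obs0 f s t - (t - s)\<bar> \<le> (t - s) / 2" by simp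
  then show "(t - s) / 2 \<le> 1 / obs0 f s t" "1 / obs0 f s t \<le> 3 / 2 * (t - s)"
    unfolding abs_le_iff by argo+
qed

lemma small_scale_exists:
  fixes \<alpha> A \<epsilon> :: real
  assumes "0 < \<alpha>" "0 < A" "0 < \<epsilon>"
  shows "\<exists>r>0. \<forall>h. 0 \<le> h \<and> h \<le> r \<longrightarrow> A * h powr \<alpha> \<le> \<epsilon>"
proof (intro exI conjI allI impI)
  let ?r = "(\<epsilon> / A) powr (1 / \<alpha>)"
  show "0 < ?r" using assms by simp
  fix h :: real assume h: "0 \<le> h \<and> h \<le> ?r"
  have "h powr \<alpha> \<le> ?r powr \<alpha>" using h assms by (intro powr_mono2) auto
  also have "\<dots> = \<epsilon> / A" using assms by (simp add: powr_powr)
  finally show "A * h powr \<alpha> \<le> \<epsilon>" using assms by (simp add: field_simps)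
qed

section \<open>Local Harnack inequality and local bounds\<close>

text \<open>
  In the three-point identity for \<open>m - h\<close>, \<open>m\<close>, \<open>m + h\<close> both terms on the right are positive, so
  each is at most the left-hand side. The factors \<open>1 / obs0\<close> lie within \<open>1 / 2\<close> and \<open>3 / 2\<close> times the
  distances, whence the constant \<open>3 h / (h / 2) = 6\<close>.
\<close>

lemma recip_root_deriv_le_midpoint:
  assumes f: "f \<in> LocHolObs \<alpha> x \<delta> A" and h: "0 < h" and m: "x - \<delta> < m - h" "m + h < x + \<delta>"
    and small: "A * h powr \<alpha> \<le> 1 / 4" "A * (2 * h) powr \<alpha> \<le> 1 / 4"
  shows "recip_root_deriv f (m - h) \<le> 6 * recip_root_deriv f m"
    and "recip_root_deriv f (m + h) \<le> 6 * recip_root_deriv f m"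
proof -
  have fC: "f \<in> C1_0p" using f by (simp add: LocHolObs_def)
  let ?v = "recip_root_deriv f"
  have pos: "0 < ?v t" for t by (rule recip_root_deriv_pos[OF fC])
  have le: "1 / obs0 f (m - h) (m + h) \<le> 3 * h" "h / 2 \<le> 1 / obs0 f (m - h) m"
      "h / 2 \<le> 1 / obs0 f m (m + h)"
    using inverse_obs0_bounds[OF f, of "m - h" "m + h"] inverse_obs0_bounds[OF f, of "m - h" m]
      inverse_obs0_bounds[OF f, of m "m + h"] h m small by auto
  have "?v (m + h) * (h / 2) + ?v (m - h) * (h / 2)
      \<le> ?v (m + h) * (1 / obs0 f (m - h) m) + ?v (m - h) * (1 / obs0 f m (m + h))"
    using le pos by (intro add_mono mult_left_mono) (auto simp: less_imp_le)
  also have "\<dots> = ?v m * (1 / obs0 f (m - h) (m + h))"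
    using recip_root_deriv_three_points[OF fC, of "m - h" m "m + h"] h by simp
  also have "\<dots> \<le> ?v m * (3 * h)"
    using le pos by (intro mult_left_mono) (auto simp: less_imp_le)
  finally have "(?v (m + h) + ?v (m - h)) * h \<le> (6 * ?v m) * h" by (simp add: algebra_simps)
  then have "?v (m + h) + ?v (m - h) \<le> 6 * ?v m" using h by simp
  then show "?v (m - h) \<le> 6 * ?v m" "?v (m + h) \<le> 6 * ?v m"
    using pos[of "m + h"] pos[of "m - h"] by linarith+
qed

text \<open>
  Either point can serve as the midpoint of the other one and its reflection.
\<close>

lemma recip_root_deriv_Harnack:
  assumes "0 < \<alpha>" "0 < A" "0 < \<delta>"
  shows "\<exists>r>0. \<forall>f\<in>LocHolObs \<alpha> x \<delta> A. \<forall>y\<in>ball x r. \<forall>z\<in>ball x r.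
    recip_root_deriv f y \<le> 6 * recip_root_deriv f z"
proof -
  obtain r0 where r0: "0 < r0" "\<And>h. 0 \<le> h \<Longrightarrow> h \<le> r0 \<Longrightarrow> A * h powr \<alpha> \<le> 1 / 4"
    using small_scale_exists[OF assms(1,2), of "1 / 4"] by auto
  \<comment> \<open>The reflected point \<open>2 z - y\<close> can be up to \<open>3 r\<close> away from \<open>x\<close>, and up to \<open>4 r\<close> away from \<open>y\<close>.\<close>
  define r where "r = min (\<delta> / 3) (r0 / 4)"
  have r: "0 < r" "3 * r \<le> \<delta>" "4 * r \<le> r0" using r0 assms by (auto simp: r_def)
  have "recip_root_deriv f y \<le> 6 * recip_root_deriv f z"
    if f: "f \<in> LocHolObs \<alpha> x \<delta> A" and yz: "y \<in> ball x r" "z \<in> ball x r" for f y z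
  proof (cases y z rule: linorder_cases)
    case less
    then show ?thesis
      using recip_root_deriv_le_midpoint(1)[OF f, of "z - y" z] r yz r0(2)
      by (auto simp: dist_real_def)
  next
    case equal
    then show ?thesis using recip_root_deriv_pos[of f z] f by (auto simp: LocHolObs_def)
  next
    case greater
    then show ?thesis
      using recip_root_deriv_le_midpoint(2)[OF f, of "y - z" z] r yz r0(2)
      by (auto simp: dist_real_def)
  qed
  with r(1) show ?thesis by blast
qed

text \<open>
  By the Harnack inequality, having a bound uniform in \<open>f \<in> K\<close> at a point is a property that
  spreads to a neighbourhood whose size does not depend on the bound. It holds at 0 by the
  normalisation \<open>deriv f 0 = 1\<close>, hence everywhere because the line is connected.
\<close>

lemma recip_root_deriv_bounds:
  assumes \<alpha>: "0 < \<alpha>" and K: "K \<subseteq> C1_0p"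
    and loc: "\<And>x. \<exists>A \<delta>. 0 < A \<and> 0 < \<delta> \<and> K \<subseteq> LocHolObs \<alpha> x \<delta> A"
  shows "\<exists>r>0. \<exists>B>0. \<forall>f\<in>K. \<forall>y\<in>ball x r. recip_root_deriv f y \<le> B \<and> 1 / B \<le> recip_root_deriv f y"
proof -
  have Harnack: "\<exists>r>0. \<forall>f\<in>K. \<forall>y\<in>ball x r. \<forall>z\<in>ball x r.
      recip_root_deriv f y \<le> 6 * recip_root_deriv f z" for x
  proof -
    obtain A \<delta> where A: "0 < A" "0 < \<delta>" "K \<subseteq> LocHolObs \<alpha> x \<delta> A" using loc by blast
    show ?thesis using recip_root_deriv_Harnack[OF \<alpha> A(1,2), of x] A(3) by blast
  qed
  define bdd where "bdd S \<longleftrightarrow> (\<exists>B>0. \<forall>f\<in>K. \<forall>y\<in>S.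
    recip_root_deriv f y \<le> B \<and> 1 / B \<le> recip_root_deriv f y)" for S
  have spread: "bdd (ball x r)"
    if r: "\<forall>f\<in>K. \<forall>y\<in>ball x r. \<forall>z\<in>ball x r. recip_root_deriv f y \<le> 6 * recip_root_deriv f z"
      and z: "z \<in> ball x r" and bz: "bdd {z}" for x r z
  proof -
    obtain B where B: "B > 0" "\<And>f. f \<in> K \<Longrightarrow> recip_root_deriv f z \<le> B"
        "\<And>f. f \<in> K \<Longrightarrow> 1 / B \<le> recip_root_deriv f z"
      using bz unfolding bdd_def by blast
    have "recip_root_deriv f y \<le> 6 * B \<and> 1 / (6 * B) \<le> recip_root_deriv f y"
      if "f \<in> K" "y \<in> ball x r" for f y
    proof
      have "recip_root_deriv f y \<le> 6 * recip_root_deriv f z" using r z that by blast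
      then show "recip_root_deriv f y \<le> 6 * B" using B(2)[OF that(1)] by linarith
      have "recip_root_deriv f z \<le> 6 * recip_root_deriv f y" using r z that by blast
      then have "1 / B \<le> 6 * recip_root_deriv f y" using B(3)[OF that(1)] by linarith
      then show "1 / (6 * B) \<le> recip_root_deriv f y" using B(1) by (simp add: field_simps)
    qed
    moreover have "0 < 6 * B" using B(1) by simp
    ultimately show ?thesis unfolding bdd_def by blast
  qed
  have "bdd {x}"
  proof (rule connected_induction_simple[of UNIV "0 :: real" x])
    have "recip_root_deriv f 0 = 1" if "f \<in> K" for f using recip_root_deriv_0 K that by blast
    then show "bdd {0}" unfolding bdd_def by (intro exI[of _ 1]) simp
    fix c :: real
    obtain r where r: "r > 0" "\<forall>f\<in>K. \<forall>y\<in>ball c r. \<forall>z\<in>ball c r.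
        recip_root_deriv f y \<le> 6 * recip_root_deriv f z" using Harnack by blast
    have "bdd {y}" if "z \<in> ball c r" "y \<in> ball c r" "bdd {z}" for y z
      using spread[OF r(2) that(1,3)] that(2) unfolding bdd_def by blast
    moreover have "openin (top_of_set UNIV) (ball c r)" "c \<in> ball c r" using r(1) by simp_all
    ultimately show "\<exists>T. openin (top_of_set UNIV) T \<and> c \<in> T \<and>
        (\<forall>z\<in>T. \<forall>y\<in>T. bdd {z} \<longrightarrow> bdd {y})" by blast
  qed auto
  moreover obtain r where "r > 0" "\<forall>f\<in>K. \<forall>y\<in>ball x r. \<forall>z\<in>ball x r.
      recip_root_deriv f y \<le> 6 * recip_root_deriv f z" using Harnack by blast
  ultimately have "bdd (ball x r)" using spread[of x r x] by simp
  with \<open>r > 0\<close> show ?thesis unfolding bdd_def by blast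
qed

section \<open>Equicontinuity of the derivatives\<close>

text \<open>
  The third point \<open>s + r\<close> stays at a fixed distance, and this is what makes \<open>m\<close> and \<open>s\<close>
  comparable: in the three-point identity \<open>v m\<close> and \<open>v s\<close> both have factors close to \<open>r\<close>, whereas
  the factor of \<open>v (s + r)\<close> is of order \<open>m - s\<close>. Only \<open>\<theta>\<close>, the error at scale \<open>r\<close>, does not
  disappear as \<open>m\<close> tends to \<open>s\<close>.
\<close>

lemma recip_root_deriv_increment:
  assumes f: "f \<in> LocHolObs \<alpha> x \<delta> A" and st: "x - \<delta> < s" "s < m" "m < s + r" "s + r < x + \<delta>"
    and small: "\<And>h. 0 \<le> h \<Longrightarrow> h \<le> r \<Longrightarrow> A * h powr \<alpha> \<le> \<theta>" and \<theta>: "0 \<le> \<theta>" "\<theta> \<le> 1 / 4"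
    and B: "recip_root_deriv f s \<le> B" "recip_root_deriv f m \<le> B" "recip_root_deriv f (s + r) \<le> B"
  shows "\<bar>recip_root_deriv f m - recip_root_deriv f s\<bar> \<le> B * (4 * \<theta> + 3 * ((m - s) / r))"
proof -
  have fC: "f \<in> C1_0p" using f by (simp add: LocHolObs_def)
  let ?v = "recip_root_deriv f"
  have pos: "0 < ?v t" for t by (rule recip_root_deriv_pos[OF fC])
  define p q k where "p = 1 / obs0 f s (s + r)" and "q = 1 / obs0 f m (s + r)"
    and "k = 1 / obs0 f s m"
  have r: "0 < r" using st by linarith
  have p: "\<bar>p - r\<bar> \<le> 2 * \<theta> * r"
    using inverse_obs0_approx[OF f, of s "s + r" \<theta>] st small \<theta> r by (simp add: p_def)
  have q: "\<bar>q - (s + r - m)\<bar> \<le> 2 * \<theta> * (s + r - m)"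
    using inverse_obs0_approx[OF f, of m "s + r" \<theta>] st small \<theta> r by (simp add: q_def)
  have "2 * \<theta> * (s + r - m) \<le> 2 * \<theta> * r" using \<theta> st by (intro mult_left_mono) auto
  with q have "\<bar>q - (s + r - m)\<bar> \<le> 2 * \<theta> * r" by (rule order_trans)
  moreover have "\<bar>q - r\<bar> \<le> \<bar>q - (s + r - m)\<bar> + (m - s)" using st by linarith
  ultimately have q': "\<bar>q - r\<bar> \<le> 2 * \<theta> * r + (m - s)" by linarith
  have "A * (m - s) powr \<alpha> \<le> 1 / 4" using small[of "m - s"] st \<theta> by simp
  then have k: "0 \<le> k" "k \<le> 2 * (m - s)"
    using inverse_obs0_bounds[OF f, of s m, folded k_def] st by auto
  have eq: "?v m * p = ?v (s + r) * k + ?v s * q"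
    using recip_root_deriv_three_points[OF fC st(2,3)] by (simp add: p_def q_def k_def)
  have "(?v m - ?v s) * r = ?v (s + r) * k + ?v s * (q - r) - ?v m * (p - r)"
    using eq by (simp add: algebra_simps)
  then have "\<bar>?v m - ?v s\<bar> * r \<le> \<bar>?v (s + r) * k\<bar> + \<bar>?v s * (q - r)\<bar> + \<bar>?v m * (p - r)\<bar>"
    using abs_mult_pos[of r "?v m - ?v s"] r by linarith
  also have "\<dots> = ?v (s + r) * k + ?v s * \<bar>q - r\<bar> + ?v m * \<bar>p - r\<bar>"
    using pos k by (simp add: abs_mult less_imp_le abs_of_pos)
  also have "\<dots> \<le> B * (2 * (m - s)) + B * (2 * \<theta> * r + (m - s)) + B * (2 * \<theta> * r)"
    using B k p q' pos[of s] by (intro add_mono mult_mono) auto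
  also have "\<dots> = B * (4 * \<theta> + 3 * ((m - s) / r)) * r" using r by (simp add: field_simps)
  finally show ?thesis using r by simp
qed

lemma recip_root_deriv_equicontinuous:
  assumes \<alpha>: "0 < \<alpha>" and A: "0 < A" "0 < \<delta>" and K: "K \<subseteq> LocHolObs \<alpha> x \<delta> A"
    and \<rho>: "0 < \<rho>" "0 < B" "\<And>f y. f \<in> K \<Longrightarrow> y \<in> ball x \<rho> \<Longrightarrow> recip_root_deriv f y \<le> B"
    and e: "0 < e"
  shows "\<exists>d>0. \<forall>f\<in>K. \<forall>y\<in>ball x d. \<bar>recip_root_deriv f y - recip_root_deriv f x\<bar> \<le> e"
proof -
  \<comment> \<open>Half of \<open>e\<close> is spent on the error at scale \<open>r\<close>, namely \<open>4 B \<theta> \<le> e / 2\<close>, and half on the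
    displacement, namely \<open>3 B d / r \<le> e / 2\<close>.\<close>
  define \<theta> where "\<theta> = min (1 / 4) (e / (8 * B))"
  have \<theta>: "0 < \<theta>" "\<theta> \<le> 1 / 4" "8 * B * \<theta> \<le> e" using e \<rho> by (auto simp: \<theta>_def min_def field_simps)
  obtain r0 where r0: "0 < r0" "\<And>h. 0 \<le> h \<Longrightarrow> h \<le> r0 \<Longrightarrow> A * h powr \<alpha> \<le> \<theta>"
    using small_scale_exists[OF \<alpha> A(1) \<theta>(1)] by auto
  define r where "r = min r0 (min \<delta> \<rho> / 2)"
  have r: "0 < r" "r \<le> r0" "2 * r \<le> \<delta>" "2 * r \<le> \<rho>" using r0 A \<rho> by (auto simp: r_def)
  define d where "d = min r (e / (6 * B) * r)"
  have d: "0 < d" "d \<le> r" "d / r \<le> e / (6 * B)"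
    using r e \<rho> by (auto simp: d_def pos_divide_le_eq)
  \<comment> \<open>The base point \<open>s\<close> is the left one of \<open>x\<close> and \<open>y\<close>, so that \<open>s + r\<close> stays within \<open>r\<close> of \<open>x\<close> on
    the right.\<close>
  have step: "\<bar>recip_root_deriv f m - recip_root_deriv f s\<bar> \<le> e"
    if f: "f \<in> K" and sm: "s < m" "m - s < d" and s: "x - d < s" "s \<le> x" and m: "m < x + d" for f s m
  proof -
    have "\<bar>recip_root_deriv f m - recip_root_deriv f s\<bar> \<le> B * (4 * \<theta> + 3 * ((m - s) / r))"
    proof (rule recip_root_deriv_increment)
      show "f \<in> LocHolObs \<alpha> x \<delta> A" using f K by blast
      show "A * h powr \<alpha> \<le> \<theta>" if "0 \<le> h" "h \<le> r" for h using r0(2) that r by simp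
    qed (use sm s m r d \<theta> f in \<open>auto intro!: \<rho>(3) simp: dist_real_def\<close>)
    also have "\<dots> \<le> B * (4 * \<theta> + 3 * (e / (6 * B)))"
    proof -
      have "(m - s) / r \<le> d / r" using sm r by (simp add: divide_right_mono)
      then have "4 * \<theta> + 3 * ((m - s) / r) \<le> 4 * \<theta> + 3 * (e / (6 * B))" using d(3) by linarith
      then show ?thesis using \<rho>(2) by (intro mult_left_mono) simp_all
    qed
    also have "\<dots> \<le> e" using \<theta>(3) \<rho> by (simp add: field_simps)
    finally show ?thesis .
  qed
  have "\<bar>recip_root_deriv f y - recip_root_deriv f x\<bar> \<le> e" if "f \<in> K" "y \<in> ball x d" for f y
    using step[OF that(1), of x y] step[OF that(1), of y x] that(2) e
    by (cases y x rule: linorder_cases) (auto simp: dist_real_def abs_minus_commute)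
  with d(1) show ?thesis by blast
qed

lemma abs_inverse_square_diff_le:
  fixes u v B :: real
  assumes "0 < B" "1 / B \<le> u" "u \<le> B" "1 / B \<le> v" "v \<le> B"
  shows "\<bar>1 / u\<^sup>2 - 1 / v\<^sup>2\<bar> \<le> 2 * B ^ 5 * \<bar>u - v\<bar>"
proof -
  have pos: "0 < u" "0 < v" using assms by (meson divide_pos_pos less_le_trans zero_less_one)+
  have "1 / u \<le> B" "1 / v \<le> B" using assms pos by (simp_all add: field_simps)
  then have inv: "(1 / u)\<^sup>2 \<le> B\<^sup>2" "(1 / v)\<^sup>2 \<le> B\<^sup>2" using pos by (intro power_mono; simp)+
  have "1 / u\<^sup>2 - 1 / v\<^sup>2 = (v + u) * (v - u) * ((1 / u)\<^sup>2 * (1 / v)\<^sup>2)"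
    using pos by (simp add: field_simps power2_eq_square)
  then have "\<bar>1 / u\<^sup>2 - 1 / v\<^sup>2\<bar> = (v + u) * \<bar>u - v\<bar> * ((1 / u)\<^sup>2 * (1 / v)\<^sup>2)"
    using pos by (simp add: abs_mult abs_minus_commute)
  also have "\<dots> \<le> (B + B) * \<bar>u - v\<bar> * (B\<^sup>2 * B\<^sup>2)"
    using assms inv pos by (intro mult_mono add_mono) auto
  also have "\<dots> = 2 * B ^ 5 * \<bar>u - v\<bar>" by (simp add: eval_nat_numeral algebra_simps)
  finally show ?thesis .
qed

theorem corollary10:
  fixes \<alpha> :: real and K :: "(real \<Rightarrow> real) set"
  assumes "0 < \<alpha>" and "\<alpha> < 1"
    and "K \<subseteq> C1_0p"
    and "\<And>x. \<exists>A \<delta>. 0 < A \<and> 0 < \<delta> \<and> K \<subseteq> LocHolObs \<alpha> x \<delta> A"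
  shows "precompactin C1_0p_topology K"
proof (rule precompactin_C1_0p_topologyI[OF assms(3)])
  have fC: "f \<in> C1_0p" if "f \<in> K" for f using assms(3) that by blast
  note bounds = recip_root_deriv_bounds[OF assms(1,3,4)]
  fix t :: real
  obtain \<rho> B where \<rho>: "0 < \<rho>" "0 < B"
      "\<And>f y. f \<in> K \<Longrightarrow> y \<in> ball t \<rho> \<Longrightarrow> recip_root_deriv f y \<le> B"
      "\<And>f y. f \<in> K \<Longrightarrow> y \<in> ball t \<rho> \<Longrightarrow> 1 / B \<le> recip_root_deriv f y"
    using bounds[of t] by blast
  have "1 / B\<^sup>2 \<le> deriv f t \<and> deriv f t \<le> B\<^sup>2" if f: "f \<in> K" for f
  proof -
    let ?v = "recip_root_deriv f t"
    have v: "0 < ?v" "?v \<le> B" "1 / B \<le> ?v"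
      using recip_root_deriv_pos fC f \<rho> by auto
    then have "1 / B \<le> 1 / ?v" "1 / ?v \<le> B" using \<rho>(2) by (simp_all add: field_simps)
    then have "(1 / B)\<^sup>2 \<le> (1 / ?v)\<^sup>2" "(1 / ?v)\<^sup>2 \<le> B\<^sup>2"
      using v \<rho>(2) by (intro power_mono; simp)+
    then show ?thesis
      using deriv_eq_recip_root_deriv[OF fC[OF f]] by (simp add: power_divide)
  qed
  with \<rho>(2) show "\<exists>a b. 0 < a \<and> (\<forall>f\<in>K. a \<le> deriv f t \<and> deriv f t \<le> b)"
    by (intro exI[of _ "1 / B\<^sup>2"] exI[of _ "B\<^sup>2"]) auto
  fix e :: real assume e: "0 < e"
  obtain A \<delta> where A: "0 < A" "0 < \<delta>" "K \<subseteq> LocHolObs \<alpha> t \<delta> A" using assms(4) by blast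
  have "0 < e / (2 * B ^ 5)" using e \<rho>(2) by simp
  from recip_root_deriv_equicontinuous[OF assms(1) A \<rho>(1-3) this]
  obtain d where d: "0 < d" "\<And>f s. f \<in> K \<Longrightarrow> s \<in> ball t d \<Longrightarrow>
      \<bar>recip_root_deriv f s - recip_root_deriv f t\<bar> \<le> e / (2 * B ^ 5)" by blast
  have "\<bar>deriv f s - deriv f t\<bar> \<le> e" if f: "f \<in> K" and s: "\<bar>s - t\<bar> < min d \<rho>" for f s
  proof -
    have s': "s \<in> ball t d" "s \<in> ball t \<rho>" "t \<in> ball t \<rho>"
      using s \<rho>(1) by (auto simp: dist_real_def abs_minus_commute)
    have "\<bar>deriv f s - deriv f t\<bar> \<le>
        2 * B ^ 5 * \<bar>recip_root_deriv f s - recip_root_deriv f t\<bar>"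
      unfolding deriv_eq_recip_root_deriv[OF fC[OF f]]
      by (rule abs_inverse_square_diff_le) (use \<rho> f s' in auto)
    also have "\<dots> \<le> 2 * B ^ 5 * (e / (2 * B ^ 5))"
      using d(2)[OF f s'(1)] \<rho>(2) by (intro mult_left_mono) auto
    also have "\<dots> = e" using \<rho>(2) by simp
    finally show ?thesis .
  qed
  with d(1) \<rho>(1) show "\<exists>d>0. \<forall>f\<in>K. \<forall>s. \<bar>s - t\<bar> < d \<longrightarrow> \<bar>deriv f s - deriv f t\<bar> \<le> e"
    by (intro exI[of _ "min d \<rho>"]) auto
qed

end
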